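(* Let $\mathcal C$ be the linear code over $\mathbb F_4$ generated by the $3\times 21$ matrix $$G=\left(\begin{array}{c|cccc|cccc|cccc|cccc|cccc} 0&0&0&0&0&1&1&1&1&1&1&1&1&1&1&1&w^2&1&1&w&1\\ 1&0&1&1&1&w^2&1&w&0&w^2&w&0&1&w^2&0&1&1&0&1&1&w\\ 0&1&w&w^2&1&0&0&0&0&1&1&1&1&w&w&w&1&w^2&w^2&1&w^2 \end{array}\right).$$ Then $\mathcal C$ is an optimal quaternary $[21,3,16]$ $(r,\delta)$-LRC code with $r=2$, $\delta=4$. Moreover, puncturing $\mathcal C$ on the coordinate set $S$ gives an optimal quaternary $[d+5,3,d]$ $(r,\delta)$-LRC code with $r=2$, $\delta=4$, where: $d=15$ for $S=\{2\}$; $d=14$ for $S=\{2,3\}$; $d=13$ for $S=\{2,3,4\}$; $d=12$ for $S=\{2,3,4,5\}$; $d=11$ for $S=\{13,17,18,19,21\}$; $d=10$ for $S=\{15,16,17,18,19,21\}$; $d=9$ for $S=\{12,13,16,17,18,19,21\}$; $d=8$ for $S=\{14,15,\dots,21\}$; $d=7$ for $S=\{11,12,13,15,16,17,18,19,21\}$.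
   Context: $\mathbb F_4=\{0,1,w,w^2\}$ with $w^2=w+1$, $w^3=1$. Puncturing a code on $S$ means deleting the coordinates indexed by $S$ from all codewords. For a linear code $\mathcal C\subseteq\mathbb{F}_q^n$ and $R\subseteq[n]=\{1,\dots,n\}$, $\mathcal C|_R$ is the code obtained by puncturing the coordinates outside $R$. An $[n,k,d]$ linear code $\mathcal C$ is an $(r,\delta)$-LRC code if for every $i\in[n]$ there is $R_i\subseteq[n]$ with $i\in R_i$, $|R_i|\le r+\delta-1$, such that $\mathcal C|_{R_i}$ has minimum distance at least $\delta$ (every nonzero word has weight at least $\delta$). Every such code satisfies $d\le n-k+1-(\lceil k/r\rceil-1)(\delta-1)$; it is $d$-optimal if equality holds. An $(r,\delta)$-LRC code is $r$-optimal if it is not an $(r',\delta)$-LRC code for any $1\le r'<r$. "Optimal $(r,\delta)$-LRC code" means an $(r,\delta)$-LRC code that is both $d$-optimal and $r$-optimal, with $d\ge\delta>2$ and $k>r\ge1$. *)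

theory Defs
  imports Complex_Main "Jordan_Normal_Form.VS_Connect"
begin

section \<open>The field with four elements\<close>

text \<open>The libraries contain no type that is the field with four elements, so it is given here by
  its addition and multiplication tables; the lemmas after the instance proof check the
  presentation: the elements are \<open>0\<close>, \<open>1\<close>, \<open>w\<close>, \<open>w^2\<close>, with \<open>w^2 = w + 1\<close> and \<open>w^3 = 1\<close>.\<close>

datatype gf4 = F0 | F1 | w | w2

instantiation gf4 :: field
begin

definition zero_gf4 :: gf4 where "0 = F0"
definition one_gf4 :: gf4 where "1 = F1"

fun plus_gf4 :: "gf4 \<Rightarrow> gf4 \<Rightarrow> gf4" where
  "F0 + y = y"
| "x + F0 = x"
| "F1 + F1 = F0" | "F1 + w = w2" | "F1 + w2 = w"
| "w + F1 = w2" | "w + w = F0" | "w + w2 = F1"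
| "w2 + F1 = w" | "w2 + w = F1" | "w2 + w2 = F0"

fun times_gf4 :: "gf4 \<Rightarrow> gf4 \<Rightarrow> gf4" where
  "F0 * y = F0"
| "x * F0 = F0"
| "F1 * y = y"
| "x * F1 = x"
| "w * w = w2" | "w * w2 = F1"
| "w2 * w = F1" | "w2 * w2 = w"

definition uminus_gf4 :: "gf4 \<Rightarrow> gf4" where "- x = (x :: gf4)"
definition minus_gf4 :: "gf4 \<Rightarrow> gf4 \<Rightarrow> gf4" where "x - y = x + (y :: gf4)"

fun inverse_gf4 :: "gf4 \<Rightarrow> gf4" where
  "inverse F0 = F0" | "inverse F1 = F1" | "inverse w = w2" | "inverse w2 = w"

definition divide_gf4 :: "gf4 \<Rightarrow> gf4 \<Rightarrow> gf4" where "x div y = x * inverse (y :: gf4)"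

instance
proof
  fix a b c :: gf4
  show "a + b + c = a + (b + c)" by (cases a; cases b; cases c) simp_all
  show "a + b = b + a" by (cases a; cases b) simp_all
  show "0 + a = a" by (simp add: zero_gf4_def)
  show "- a + a = 0" by (cases a) (simp_all add: uminus_gf4_def zero_gf4_def)
  show "a - b = a + - b" by (simp add: minus_gf4_def uminus_gf4_def)
  show "a * b * c = a * (b * c)" by (cases a; cases b; cases c) simp_all
  show "a * b = b * a" by (cases a; cases b) simp_all
  show "1 * a = a" by (cases a) (simp_all add: one_gf4_def)
  show "(a + b) * c = a * c + b * c" by (cases a; cases b; cases c) simp_all
  show "(0 :: gf4) \<noteq> 1" by (simp add: zero_gf4_def one_gf4_def)
  show "a \<noteq> 0 \<Longrightarrow> inverse a * a = 1" by (cases a) (simp_all add: zero_gf4_def one_gf4_def)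
  show "a div b = a * inverse b" by (simp add: divide_gf4_def)
  show "inverse (0 :: gf4) = 0" by (simp add: zero_gf4_def)
qed

end

lemma w_power2: "w ^ 2 = w + 1"
  by (simp add: power2_eq_square one_gf4_def)

lemma w_power3: "w ^ 3 = 1"
  by (simp add: power3_eq_cube one_gf4_def)

lemma UNIV_gf4: "(UNIV :: gf4 set) = {0, 1, w, w ^ 2}"
  unfolding set_eq_iff
  by (auto simp: zero_gf4_def one_gf4_def power2_eq_square intro: gf4.exhaust)

lemma card_UNIV_gf4: "card (UNIV :: gf4 set) = 4"
  by (simp add: UNIV_gf4 zero_gf4_def one_gf4_def power2_eq_square)


section \<open>Linear codes\<close>

definition linear_code :: "nat \<Rightarrow> 'a :: field vec set \<Rightarrow> bool" where
  "linear_code n C \<longleftrightarrow> VectorSpace.subspace class_ring C (module_vec TYPE('a) n)"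

definition code_dim :: "nat \<Rightarrow> 'a :: field vec set \<Rightarrow> nat" where
  "code_dim n C = vectorspace.dim class_ring ((module_vec TYPE('a) n)\<lparr>carrier := C\<rparr>)"

definition hamming_weight :: "'a :: zero vec \<Rightarrow> nat" where
  "hamming_weight x = card {i. i < dim_vec x \<and> x $ i \<noteq> 0}"

definition hamming_dist :: "'a vec \<Rightarrow> 'a vec \<Rightarrow> nat" where
  "hamming_dist x y = card {i. i < dim_vec x \<and> x $ i \<noteq> y $ i}"

definition min_dist :: "'a vec set \<Rightarrow> nat" where
  "min_dist C = Inf {hamming_dist x y | x y. x \<in> C \<and> y \<in> C \<and> x \<noteq> y}"

text \<open>A lower bound on the minimum distance of a linear code is a lower bound on the weights of its
  nonzero words. In particular the zero code has minimum distance at least \<open>\<delta>\<close> for every \<open>\<delta>\<close>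
  (whereas \<open>min_dist\<close> has the junk value \<open>0\<close> on it).\<close>

definition min_dist_at_least :: "nat \<Rightarrow> 'a :: zero vec set \<Rightarrow> bool" where
  "min_dist_at_least \<delta> C \<longleftrightarrow> (\<forall>x\<in>C. x \<noteq> 0\<^sub>v (dim_vec x) \<longrightarrow> \<delta> \<le> hamming_weight x)"

lemma min_dist_at_least_iff_dist:
  fixes C :: "'a :: field vec set"
  assumes "linear_code n C"
  shows "min_dist_at_least \<delta> C \<longleftrightarrow> (\<forall>x\<in>C. \<forall>y\<in>C. x \<noteq> y \<longrightarrow> \<delta> \<le> hamming_dist x y)"
proof -
  have sub: "submodule class_ring C (module_vec TYPE('a) n)"
    using assms by (simp add: linear_code_def VectorSpace.subspace_def)
  have carr: "C \<subseteq> carrier_vec n" and zero: "0\<^sub>v n \<in> C"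
    and add: "\<And>x y. x \<in> C \<Longrightarrow> y \<in> C \<Longrightarrow> x + y \<in> C"
    and smult: "\<And>c x. x \<in> C \<Longrightarrow> c \<cdot>\<^sub>v x \<in> C"
    using sub by (auto simp: submodule_def module_vec_simps)
  have dim: "dim_vec x = n" if "x \<in> C" for x
    using carr that by auto
  have diff: "x + (- 1) \<cdot>\<^sub>v y \<in> C" if "x \<in> C" "y \<in> C" for x y
    using that add smult by blast
  have dist: "hamming_weight (x + (- 1) \<cdot>\<^sub>v y) = hamming_dist x y" if "x \<in> C" "y \<in> C" for x y
    unfolding hamming_weight_def hamming_dist_def
    by (rule arg_cong[where f = card]) (auto simp: dim that)
  have neq: "x + (- 1) \<cdot>\<^sub>v y \<noteq> 0\<^sub>v n" if "x \<in> C" "y \<in> C" "x \<noteq> y" for x y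
  proof
    assume eq: "x + (- 1) \<cdot>\<^sub>v y = 0\<^sub>v n"
    have "x = y"
    proof (rule eq_vecI)
      fix i assume "i < dim_vec y"
      then have i: "i < n" using that dim by simp
      have "(x + (- 1) \<cdot>\<^sub>v y) $ i = 0" using eq i by simp
      then show "x $ i = y $ i" using i that dim by simp
    qed (simp add: dim that)
    with that show False by simp
  qed
  have weight: "hamming_weight x = hamming_dist x (0\<^sub>v n)" if "x \<in> C" for x
    unfolding hamming_weight_def hamming_dist_def
    by (rule arg_cong[where f = card]) (auto simp: dim that)
  show ?thesis
  proof
    assume L: "min_dist_at_least \<delta> C"
    show "\<forall>x\<in>C. \<forall>y\<in>C. x \<noteq> y \<longrightarrow> \<delta> \<le> hamming_dist x y"
    proof (intro ballI impI)
      fix x y assume xy: "x \<in> C" "y \<in> C" "x \<noteq> y"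
      have "\<delta> \<le> hamming_weight (x + (- 1) \<cdot>\<^sub>v y)"
        using L diff[OF xy(1,2)] neq[OF xy] dim[OF diff[OF xy(1,2)]]
        unfolding min_dist_at_least_def by metis
      then show "\<delta> \<le> hamming_dist x y" using dist xy by simp
    qed
  next
    assume R: "\<forall>x\<in>C. \<forall>y\<in>C. x \<noteq> y \<longrightarrow> \<delta> \<le> hamming_dist x y"
    show "min_dist_at_least \<delta> C"
      unfolding min_dist_at_least_def
      using R zero dim weight by metis
  qed
qed

definition is_code :: "nat \<Rightarrow> nat \<Rightarrow> nat \<Rightarrow> 'a :: field vec set \<Rightarrow> bool" where
  "is_code n k d C \<longleftrightarrow> linear_code n C \<and> code_dim n C = k \<and> min_dist C = d"

text \<open>Coordinates are numbered \<open>1, \<dots>, n\<close>, whereas vector entries are indexed from \<open>0\<close>: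
  coordinate \<open>i\<close> of \<open>v\<close> is \<open>v $ (i - 1)\<close>. The remaining coordinates are renumbered in order.\<close>

definition puncture_word :: "nat set \<Rightarrow> 'a vec \<Rightarrow> 'a vec" where
  "puncture_word S v =
     vec_of_list (map (\<lambda>i. v $ (i - 1)) (filter (\<lambda>i. i \<notin> S) [1..<dim_vec v + 1]))"

definition puncture :: "nat set \<Rightarrow> 'a vec set \<Rightarrow> 'a vec set" where
  "puncture S C = puncture_word S ` C"

definition restrict_code :: "nat \<Rightarrow> nat set \<Rightarrow> 'a vec set \<Rightarrow> 'a vec set" where
  "restrict_code n R C = puncture ({1..n} - R) C"


section \<open>Locally repairable codes\<close>

definition is_LRC :: "nat \<Rightarrow> nat \<Rightarrow> nat \<Rightarrow> 'a :: field vec set \<Rightarrow> bool" where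
  "is_LRC n r \<delta> C \<longleftrightarrow> linear_code n C \<and>
     (\<forall>i\<in>{1..n}. \<exists>R\<subseteq>{1..n}. i \<in> R \<and> card R \<le> r + \<delta> - 1 \<and>
        min_dist_at_least \<delta> (restrict_code n R C))"

definition d_optimal :: "nat \<Rightarrow> nat \<Rightarrow> nat \<Rightarrow> nat \<Rightarrow> nat \<Rightarrow> bool" where
  "d_optimal n k d r \<delta> \<longleftrightarrow>
     int d = int n - int k + 1 - (\<lceil>real k / real r\<rceil> - 1) * (int \<delta> - 1)"

definition r_optimal :: "nat \<Rightarrow> nat \<Rightarrow> nat \<Rightarrow> 'a :: field vec set \<Rightarrow> bool" where
  "r_optimal n r \<delta> C \<longleftrightarrow> (\<forall>r'. 1 \<le> r' \<and> r' < r \<longrightarrow> \<not> is_LRC n r' \<delta> C)"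

definition optimal_LRC ::
  "nat \<Rightarrow> nat \<Rightarrow> nat \<Rightarrow> nat \<Rightarrow> nat \<Rightarrow> 'a :: field vec set \<Rightarrow> bool" where
  "optimal_LRC n k d r \<delta> C \<longleftrightarrow>
     is_code n k d C \<and> is_LRC n r \<delta> C \<and> d_optimal n k d r \<delta> \<and> r_optimal n r \<delta> C \<and>
     d \<ge> \<delta> \<and> \<delta> > 2 \<and> k > r \<and> r \<ge> 1"


section \<open>The generator matrix\<close>

definition G :: "gf4 mat" where
  "G = mat_of_rows_list 21
    [[0, 0, 0, 0,   0, 1,   1, 1, 1, 1,   1, 1, 1, 1,   1, 1, w^2, 1,   1,   w, 1],
     [1, 0, 1, 1,   1, w^2, 1, w, 0, w^2, w, 0, 1, w^2, 0, 1, 1,   0,   1,   1, w],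
     [0, 1, w, w^2, 1, 0,   0, 0, 0, 1,   1, 1, 1, w,   w, w, 1,   w^2, w^2, 1, w^2]]"

text \<open>The code generated by \<open>G\<close>, i.e. the span of its rows in the space of vectors of
  length \<open>21\<close>.\<close>

definition C\<^sub>G :: "gf4 vec set" where
  "C\<^sub>G = vec_space.row_space 21 G"

end

(* Puncturing a code of dimension three only deletes columns of a generator matrix. Regarded as
   points of the projective plane over F_4, the 21 columns are pairwise independent. A codeword is
   a linear form evaluated at these points, and its zeros are the points on a line, at most five in
   number; so the minimum distance is n - 5 as soon as some line is fully contained in the remaining
   point set. Two distinct lines share at most one point; thus the restriction of the code to the five
   points of a line has minimum distance at least 4. Hence locality (2, 4) only requires that every
   remaining point lies on a line that is fully contained in the remaining set. Locality (1, 4)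
   fails, because two independent columns are separated by a codeword that vanishes at one of
   them and not at the other. *)
theory Submission
  imports Defs
begin

section \<open>Linear forms in three variables\<close>

fun dot :: "'a::field \<times> 'a \<times> 'a \<Rightarrow> 'a \<times> 'a \<times> 'a \<Rightarrow> 'a" where
  "dot (a, b, c) (x, y, z) = a * x + b * y + c * z"

fun cross :: "'a::field \<times> 'a \<times> 'a \<Rightarrow> 'a \<times> 'a \<times> 'a \<Rightarrow> 'a \<times> 'a \<times> 'a" where
  "cross (a, b, c) (x, y, z) = (b * z - c * y, c * x - a * z, a * y - b * x)"

text \<open>A quantifier-free test that can be evaluated: the cross product vanishes exactly when
  the two vectors are linearly dependent, so this says that \<open>p\<close> and \<open>q\<close>
  represent different points of the projective plane.\<close>

definition independent :: "'a::field \<times> 'a \<times> 'a \<Rightarrow> 'a \<times> 'a \<times> 'a \<Rightarrow> bool" where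
  "independent p q \<longleftrightarrow> cross p q \<noteq> (0, 0, 0)"

lemma dot_zero [simp]: "dot (0, 0, 0) p = 0"
  by (cases p) simp

lemma independent_imp_nonzero:
  assumes "independent p q"
  shows "p \<noteq> (0, 0, 0)" "q \<noteq> (0, 0, 0)"
  using assms by (cases p; cases q; auto simp: independent_def)+

lemma ex_dot_nonzero:
  assumes "p \<noteq> (0, 0, 0)"
  shows "\<exists>t. dot t p \<noteq> 0"
proof -
  obtain x y z where "p = (x, y, z)" by (cases p)
  then have "dot (1, 0, 0) p \<noteq> 0 \<or> dot (0, 1, 0) p \<noteq> 0 \<or> dot (0, 0, 1) p \<noteq> 0"
    using assms by auto
  then show ?thesis by blast
qed

text \<open>The form \<open>cross v p\<close> vanishes at \<open>p\<close>, and its value at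
  \<open>q\<close> is the triple product of \<open>v\<close>, \<open>p\<close>, \<open>q\<close>; a
  suitable \<open>v\<close> makes that nonzero.\<close>

lemma independent_separated:
  assumes "independent p q"
  obtains t where "dot t p = 0" "dot t q \<noteq> 0"
proof -
  obtain v where "dot v (cross p q) \<noteq> 0"
    using assms ex_dot_nonzero unfolding independent_def by blast
  moreover have "dot (cross v p) q = dot v (cross p q)" "dot (cross v p) p = 0"
    by (cases v; cases p; cases q; simp add: algebra_simps)+
  ultimately show ?thesis using that by metis
qed

text \<open>The line through two different points is unique: its forms are the scalar multiples of
  \<open>cross p q\<close>.\<close>

lemma dot_proportional:
  assumes "dot t p = 0" "dot t q = 0" "independent p q"
  shows "\<exists>\<alpha>. \<forall>u. dot t u = \<alpha> * dot (cross p q) u"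
proof -
  obtain a b c where t: "t = (a, b, c)" by (cases t)
  obtain x y z where p: "p = (x, y, z)" by (cases p)
  obtain x' y' z' where q: "q = (x', y', z')" by (cases q)
  define l m n where lmn: "l = y * z' - z * y'" "m = z * x' - x * z'" "n = x * y' - y * x'"
  have c: "cross p q = (l, m, n)" by (simp add: p q lmn)
  \<comment> \<open>Up to sign, these are the coordinates of the double cross product of
    \<open>t\<close> with \<open>cross p q\<close>, expanded as \<open>dot t q\<close> times
    \<open>p\<close> minus \<open>dot t p\<close> times \<open>q\<close>.\<close>
  have "a * m - b * l = z * dot t q - z' * dot t p" "a * n - c * l = y' * dot t p - y * dot t q"
    "b * n - c * m = x * dot t q - x' * dot t p"
    by (simp_all add: t p q lmn algebra_simps)
  then have "a * m = b * l" "a * n = c * l" "b * n = c * m"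
    by (simp_all add: assms(1,2))
  moreover have "l \<noteq> 0 \<or> m \<noteq> 0 \<or> n \<noteq> 0"
    using assms(3) c unfolding independent_def by auto
  ultimately have "\<exists>\<alpha>. a = \<alpha> * l \<and> b = \<alpha> * m \<and> c = \<alpha> * n"
  proof (elim disjE)
    assume "l \<noteq> 0" "a * m = b * l" "a * n = c * l"
    then show ?thesis by (intro exI[of _ "a / l"]) (simp add: field_simps)
  next
    assume "m \<noteq> 0" "a * m = b * l" "b * n = c * m"
    then show ?thesis by (intro exI[of _ "b / m"]) (simp add: field_simps)
  next
    assume "n \<noteq> 0" "a * n = c * l" "b * n = c * m"
    then show ?thesis by (intro exI[of _ "c / n"]) (simp add: field_simps)
  qed
  then obtain \<alpha> where "t = (\<alpha> * l, \<alpha> * m, \<alpha> * n)" using t by blast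
  then have "dot t u = \<alpha> * dot (cross p q) u" for u
    unfolding c by (cases u) (simp add: algebra_simps)
  then show ?thesis by blast
qed

text \<open>Both forms are multiples of \<open>cross p q\<close>, and the factor for
  \<open>t\<close> is nonzero. Hence a form with two different zeros on a line vanishes on the whole
  line.\<close>

lemma dot_vanishes_on_line:
  assumes "t \<noteq> (0, 0, 0)" "dot t p = 0" "dot t q = 0" "independent p q"
    and "dot s p = 0" "dot s q = 0" "dot t u = 0"
  shows "dot s u = 0"
proof -
  obtain \<alpha> \<beta> where \<alpha>: "\<And>u. dot t u = \<alpha> * dot (cross p q) u"
    and \<beta>: "\<And>u. dot s u = \<beta> * dot (cross p q) u"
    using dot_proportional assms(2-6) by meson
  obtain a b c where t: "t = (a, b, c)" by (cases t)
  \<comment> \<open>Evaluating at the unit vectors recovers the coordinates of \<open>t\<close>,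
    which would all be zero if \<alpha> were.\<close>
  have "\<alpha> \<noteq> 0"
    using \<alpha>[of "(1, 0, 0)"] \<alpha>[of "(0, 1, 0)"] \<alpha>[of "(0, 0, 1)"] assms(1) t by auto
  then show ?thesis using \<alpha>[of u] \<beta>[of u] assms(7) by simp
qed


section \<open>The code of a list of points\<close>

text \<open>The list \<open>ps\<close> holds the columns of a generator matrix with three rows, and
  \<open>t\<close> is the message.\<close>

definition word :: "('a::field \<times> 'a \<times> 'a) list \<Rightarrow> 'a \<times> 'a \<times> 'a \<Rightarrow> 'a vec" where
  "word ps t = vec_of_list (map (dot t) ps)"

definition code_of :: "('a::field \<times> 'a \<times> 'a) list \<Rightarrow> 'a vec set" where
  "code_of ps = range (word ps)"

lemma dim_word [simp]: "dim_vec (word ps t) = length ps"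
  by (simp add: word_def)

lemma index_word [simp]: "i < length ps \<Longrightarrow> word ps t $ i = dot t (ps ! i)"
  by (simp add: word_def vec_of_list_index del: vec_of_list_map)

lemma word_in_code_of [simp]: "word ps t \<in> code_of ps"
  by (simp add: code_of_def)

lemma code_of_carrier: "code_of ps \<subseteq> carrier_vec (length ps)"
  by (auto simp: code_of_def intro: carrier_vecI)

lemma word_zero: "word ps (0, 0, 0) = 0\<^sub>v (length ps)"
  by (intro eq_vecI) auto

lemma word_add: "word ps (a, b, c) + word ps (a', b', c') = word ps (a + a', b + b', c + c')"
proof (rule eq_vecI)
  fix i assume "i < dim_vec (word ps (a + a', b + b', c + c'))"
  then show "(word ps (a, b, c) + word ps (a', b', c')) $ i = word ps (a + a', b + b', c + c') $ i"
    by (cases "ps ! i") (simp add: algebra_simps)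
qed simp

lemma word_smult: "k \<cdot>\<^sub>v word ps (a, b, c) = word ps (k * a, k * b, k * c)"
proof (rule eq_vecI)
  fix i assume "i < dim_vec (word ps (k * a, k * b, k * c))"
  then show "(k \<cdot>\<^sub>v word ps (a, b, c)) $ i = word ps (k * a, k * b, k * c) $ i"
    by (cases "ps ! i") (simp add: algebra_simps)
qed simp

lemma linear_code_code_of: "linear_code (length ps) (code_of ps)"
  unfolding linear_code_def VectorSpace.subspace_def
proof (intro conjI)
  have "0\<^sub>v (length ps) \<in> code_of ps"
    by (metis word_zero word_in_code_of)
  then show "submodule class_ring (code_of ps) (module_vec TYPE('a) (length ps))"
    unfolding submodule_def using code_of_carrier[of ps]
    by (auto simp: module_vec_simps vec_module code_of_def word_add word_smult)
qed (rule vec_vs)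

section \<open>Weights, distance bounds and dimension\<close>

lemma hamming_weight_word:
  "hamming_weight (word ps t) = length (filter (\<lambda>p. dot t p \<noteq> 0) ps)"
  unfolding hamming_weight_def length_filter_conv_card
  by (rule arg_cong[where f = card]) auto

lemma hamming_weight_word':
  "hamming_weight (word ps t) = length ps - length (filter (\<lambda>p. dot t p = 0) ps)"
  using sum_length_filter_compl[of "\<lambda>p. dot t p = 0" ps] by (simp add: hamming_weight_word)

lemma word_eq_zero_iff: "word ps t = 0\<^sub>v (length ps) \<longleftrightarrow> (\<forall>p\<in>set ps. dot t p = 0)"
proof
  assume eq: "word ps t = 0\<^sub>v (length ps)"
  then show "\<forall>p\<in>set ps. dot t p = 0"
    by (metis in_set_conv_nth index_word index_zero_vec(1))
qed (auto intro!: eq_vecI)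

text \<open>The condition is on nonzero words, not on nonzero forms: if all points lie on one line,
  a nonzero form may give the zero word.\<close>

lemma min_dist_at_least_code_of:
  "min_dist_at_least \<delta> (code_of ps) \<longleftrightarrow>
    (\<forall>t. (\<exists>p\<in>set ps. dot t p \<noteq> 0) \<longrightarrow> \<delta> \<le> length (filter (\<lambda>p. dot t p \<noteq> 0) ps))"
  by (auto simp: min_dist_at_least_def code_of_def word_eq_zero_iff hamming_weight_word)

text \<open>If no line contains all the points, encoding is injective, so the dimension of the
  message space carries over.\<close>

lemma code_dim_code_of:
  fixes ps :: "('a::field \<times> 'a \<times> 'a) list"
  assumes "\<And>t. t \<noteq> (0, 0, 0) \<Longrightarrow> \<exists>p\<in>set ps. dot t p \<noteq> 0"
  shows "code_dim (length ps) (code_of ps) = 3"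
proof -
  interpret V: vec_space "TYPE('a)" 3 .
  define W where "W = (module_vec TYPE('a) (length ps))\<lparr>carrier := code_of ps\<rparr>"
  \<comment> \<open>Encoding with the message packed as a vector, to obtain a linear map between
    vector spaces.\<close>
  define T :: "'a vec \<Rightarrow> 'a vec" where "T v = word ps (v $ 0, v $ 1, v $ 2)" for v
  have T_add: "T (u + v) = T u + T v" if "u \<in> carrier_vec 3" "v \<in> carrier_vec 3" for u v
    using that by (simp add: T_def word_add)
  have T_smult: "T (k \<cdot>\<^sub>v v) = k \<cdot>\<^sub>v T v" if "v \<in> carrier_vec 3" for k v
    using that by (simp add: T_def word_smult)
  have vs: "vectorspace class_ring W"
    unfolding W_def
    using linear_code_code_of[of ps] vectorspace.subspace_is_vs[OF vec_vs]
    unfolding linear_code_def by blast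
  have "mod_hom class_ring (module_vec TYPE('a) 3) W T"
    using vs V.vectorspace_axioms
    unfolding mod_hom_def mod_hom_axioms_def vectorspace_def LinearCombinations.module_hom_def
    by (auto simp: W_def module_vec_simps T_add T_smult) (simp add: T_def)
  then have lin: "linear_map class_ring (module_vec TYPE('a) 3) W T"
    unfolding linear_map_def using vs vec_vs by blast
  have "inj_on T (carrier_vec 3)"
  proof (rule inj_onI)
    fix u v assume uv: "u \<in> carrier_vec 3" "v \<in> carrier_vec 3" "T u = T v"
    let ?t = "(u $ 0 - v $ 0, u $ 1 - v $ 1, u $ 2 - v $ 2)"
    have "dot ?t p = 0" if p: "p \<in> set ps" for p
    proof -
      obtain i where i: "i < length ps" "p = ps ! i" using p by (metis in_set_conv_nth)
      have "T u $ i = T v $ i" using uv by simp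
      then have "dot (u $ 0, u $ 1, u $ 2) p = dot (v $ 0, v $ 1, v $ 2) p"
        using i by (simp add: T_def)
      then show ?thesis by (cases p) (simp add: algebra_simps)
    qed
    then have "?t = (0, 0, 0)" using assms by blast
    then show "u = v"
      using uv by (intro eq_vecI) (auto simp: less_Suc_eq numeral_3_eq_3 numeral_2_eq_2)
  qed
  moreover have "T ` carrier_vec 3 = code_of ps"
  proof
    show "code_of ps \<subseteq> T ` carrier_vec 3"
    proof
      fix x assume "x \<in> code_of ps"
      then obtain a b c where "x = word ps (a, b, c)" by (auto simp: code_of_def)
      then have "x = T (vec 3 (\<lambda>i. [a, b, c] ! i))" by (simp add: T_def)
      then show "x \<in> T ` carrier_vec 3" by simp
    qed
  qed (auto simp: T_def)
  ultimately have "V.dim = vectorspace.dim class_ring W"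
    using linear_map.dim_eq[OF lin V.fin_dim] by (simp add: W_def module_vec_simps)
  then show ?thesis by (simp add: code_dim_def W_def V.dim_is_n)
qed

section \<open>Puncturing and restriction as deletion of points\<close>

definition punctured_points :: "nat set \<Rightarrow> 'a list \<Rightarrow> 'a list" where
  "punctured_points S ps = map (\<lambda>i. ps ! (i - 1)) (filter (\<lambda>i. i \<notin> S) [1..<length ps + 1])"

lemma puncture_code_of: "puncture S (code_of ps) = code_of (punctured_points S ps)"
proof -
  have "puncture_word S (word ps t) = word (punctured_points S ps) t" for t
    unfolding puncture_word_def dim_word word_def[of "punctured_points S ps"]
    by (rule arg_cong[where f = vec_of_list]) (auto simp: punctured_points_def)
  then show ?thesis by (simp add: puncture_def code_of_def image_image)
qed

lemma restrict_code_of: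
  "restrict_code (length ps) R (code_of ps) = code_of (punctured_points ({1..length ps} - R) ps)"
  by (simp add: restrict_code_def puncture_code_of)

lemma length_punctured_points:
  assumes "R \<subseteq> {1..length ps}"
  shows "length (punctured_points ({1..length ps} - R) ps) = card R"
proof -
  have "set (filter (\<lambda>i. i \<notin> {1..length ps} - R) [1..<length ps + 1]) = R"
    using assms by auto
  then show ?thesis
    unfolding punctured_points_def length_map
    by (metis distinct_card distinct_filter distinct_upt)
qed

lemma map_nth_pred_upt: "map (\<lambda>i. ps ! (i - 1)) [1..<length ps + 1] = ps"
  by (rule nth_equalityI) (simp_all del: upt_Suc)

text \<open>With \<open>P\<close> the vanishing of a form, restricting to the coordinates on a line
  leaves exactly the points of that line.\<close>

lemma punctured_points_filter:
  "punctured_points ({1..length ps} - {i \<in> {1..length ps}. P (ps ! (i - 1))}) ps = filter P ps"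
proof -
  have "filter P ps = filter P (map (\<lambda>i. ps ! (i - 1)) [1..<length ps + 1])"
    by (simp only: map_nth_pred_upt)
  also have "\<dots> = map (\<lambda>i. ps ! (i - 1)) (filter (\<lambda>i. P (ps ! (i - 1))) [1..<length ps + 1])"
    by (simp add: filter_map o_def del: upt_Suc)
  also have "filter (\<lambda>i. P (ps ! (i - 1))) [1..<length ps + 1] =
      filter (\<lambda>i. i \<notin> {1..length ps} - {i \<in> {1..length ps}. P (ps ! (i - 1))}) [1..<length ps + 1]"
    by (rule filter_cong) auto
  finally show ?thesis by (simp add: punctured_points_def)
qed

lemma sorted_wrt_punctured_points:
  assumes "sorted_wrt P ps"
  shows "sorted_wrt P (punctured_points S ps)"
proof -
  have "sorted_wrt (\<lambda>i j. P (ps ! (i - 1)) (ps ! (j - 1))) [1..<length ps + 1]"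
    using assms map_nth_pred_upt[of ps] by (metis sorted_wrt_map)
  then show ?thesis
    unfolding punctured_points_def sorted_wrt_map by (rule sorted_wrt_filter)
qed


section \<open>Optimality from the geometry of the points\<close>

text \<open>A form with two zeros among these collinear points vanishes at all of them, so a nonzero
  word has at most one zero among its \<delta> + 1 entries.\<close>

lemma min_dist_line:
  assumes "sorted_wrt independent ps" "length ps = \<delta> + 1"
    and "t \<noteq> (0, 0, 0)" "\<And>p. p \<in> set ps \<Longrightarrow> dot t p = 0"
  shows "min_dist_at_least \<delta> (code_of ps)"
  unfolding min_dist_at_least_code_of
proof (intro allI impI)
  fix s assume s: "\<exists>p\<in>set ps. dot s p \<noteq> 0"
  let ?z = "filter (\<lambda>p. dot s p = 0) ps"
  have "length ?z \<le> 1"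
  proof (rule ccontr)
    assume "\<not> length ?z \<le> 1"
    \<comment> \<open>The case rule of \<open>remdups_adj\<close> separates lists of length 0, 1 and
      at least 2.\<close>
    then obtain p q zs where z: "?z = p # q # zs"
      by (cases ?z rule: remdups_adj.cases) auto
    have "sorted_wrt independent ?z" using assms(1) by (rule sorted_wrt_filter)
    then have "independent p q" using z by simp
    moreover have "p \<in> set ?z" "q \<in> set ?z" using z by simp_all
    ultimately have "dot s u = 0" if "u \<in> set ps" for u
      using dot_vanishes_on_line[OF assms(3), of p q s u] assms(4) that by simp
    then show False using s by blast
  qed
  then show "\<delta> \<le> length (filter (\<lambda>p. dot s p \<noteq> 0) ps)"
    using sum_length_filter_compl[of "\<lambda>p. dot s p = 0" ps] assms(2) by simp
qed

text \<open>With at most \<delta> coordinates, a nonzero word could have no zero entry, but a form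
  separating two of the points gives a nonzero word with one.\<close>

lemma min_dist_short_independent:
  assumes ind: "sorted_wrt independent ps" and short: "length ps \<le> \<delta>" and "1 < \<delta>"
    and p: "p \<in> set ps" "p \<noteq> (0, 0, 0)"
  shows "\<not> min_dist_at_least \<delta> (code_of ps)"
proof
  assume dist: "min_dist_at_least \<delta> (code_of ps)"
  have all: "dot t q \<noteq> 0" if "q \<in> set ps" "u \<in> set ps" "dot t u \<noteq> 0" for t q u
  proof -
    have "\<delta> \<le> length (filter (\<lambda>p. dot t p \<noteq> 0) ps)"
      using dist that unfolding min_dist_at_least_code_of by blast
    then have "filter (\<lambda>p. dot t p \<noteq> 0) ps = ps"
      using short length_filter_le[of "\<lambda>p. dot t p \<noteq> 0" ps]
      by (metis filter_True length_filter_less linorder_not_le order_trans)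
    then show ?thesis using that(1) by (metis (mono_tags, lifting) filter_id_conv)
  qed
  \<comment> \<open>The word of \<open>s\<close> is nonzero, so there are at least \<delta> > 1
    points, hence a second one.\<close>
  obtain s where "dot s p \<noteq> 0" using ex_dot_nonzero p(2) by blast
  then have "\<delta> \<le> length ps"
    using dist p(1) length_filter_le[of "\<lambda>p. dot s p \<noteq> 0" ps] order_trans
    unfolding min_dist_at_least_code_of by blast
  then obtain q u qs where qu: "ps = q # u # qs"
    using \<open>1 < \<delta>\<close> by (cases ps rule: remdups_adj.cases) auto
  then have "independent q u" using ind by simp
  then obtain t where "dot t q = 0" "dot t u \<noteq> 0" by (rule independent_separated)
  then show False using all[of q u t] qu by simp
qed

text \<open>Here \<open>m\<close> is the largest number of points on a line. A form attaining it
  gives a word of weight \<open>d\<close>, which is nonzero because \<open>d\<close> is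
  positive.\<close>

lemma min_dist_code_of:
  assumes len: "length ps = d + m" and d: "1 \<le> d"
    and le: "\<And>t. t \<noteq> (0, 0, 0) \<Longrightarrow> length (filter (\<lambda>p. dot t p = 0) ps) \<le> m"
    and t: "t \<noteq> (0, 0, 0)" "length (filter (\<lambda>p. dot t p = 0) ps) = m"
  shows "min_dist (code_of ps) = d"
  unfolding min_dist_def
proof (rule cInf_eq_minimum)
  have dist: "hamming_dist (word ps t) (0\<^sub>v (length ps)) = hamming_weight (word ps t)"
    unfolding hamming_dist_def hamming_weight_def by (rule arg_cong[where f = card]) auto
  have weight: "hamming_weight (word ps t) = d"
    using t len by (simp add: hamming_weight_word')
  then have "filter (\<lambda>p. dot t p \<noteq> 0) ps \<noteq> []"
    using d by (auto simp: hamming_weight_word)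
  then have "word ps t \<noteq> 0\<^sub>v (length ps)"
    unfolding word_eq_zero_iff filter_empty_conv by blast
  with dist weight
  show "d \<in> {hamming_dist x y |x y. x \<in> code_of ps \<and> y \<in> code_of ps \<and> x \<noteq> y}"
    using word_in_code_of[of ps t] word_in_code_of[of ps "(0, 0, 0)"] unfolding word_zero
    by (intro CollectI exI[of _ "word ps t"] exI[of _ "0\<^sub>v (length ps)"]) simp
next
  have "min_dist_at_least d (code_of ps)"
    unfolding min_dist_at_least_def
  proof (intro ballI impI)
    fix x assume x: "x \<in> code_of ps" "x \<noteq> 0\<^sub>v (dim_vec x)"
    then obtain s where s: "x = word ps s" by (auto simp: code_of_def)
    then have "s \<noteq> (0, 0, 0)" using x(2) by (auto simp: word_zero)
    then show "d \<le> hamming_weight x"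
      using le[of s] len by (simp add: s hamming_weight_word')
  qed
  then show "d \<le> x" if "x \<in> {hamming_dist x y |x y. x \<in> code_of ps \<and> y \<in> code_of ps \<and> x \<noteq> y}" for x
    using that unfolding min_dist_at_least_iff_dist[OF linear_code_code_of] by blast
qed

section \<open>Locality 2, failure of locality 1, and optimality\<close>

lemma is_LRC_code_of:
  assumes ind: "sorted_wrt independent ps"
    and cover: "\<And>p. p \<in> set ps \<Longrightarrow>
      \<exists>t. t \<noteq> (0, 0, 0) \<and> dot t p = 0 \<and> length (filter (\<lambda>p. dot t p = 0) ps) = \<delta> + 1"
  shows "is_LRC (length ps) 2 \<delta> (code_of ps)"
  unfolding is_LRC_def
proof (intro conjI ballI linear_code_code_of)
  fix i assume i: "i \<in> {1..length ps}"
  then have "ps ! (i - 1) \<in> set ps" by (intro nth_mem) auto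
  then obtain t where t: "t \<noteq> (0, 0, 0)" "dot t (ps ! (i - 1)) = 0"
    "length (filter (\<lambda>p. dot t p = 0) ps) = \<delta> + 1"
    using cover by blast
  \<comment> \<open>The repair set consists of all coordinates on the line \<open>t\<close>; its
    size \<delta> + 1 is the bound r + \<delta> - 1 for r = 2.\<close>
  define R where "R = {i \<in> {1..length ps}. dot t (ps ! (i - 1)) = 0}"
  have points: "punctured_points ({1..length ps} - R) ps = filter (\<lambda>p. dot t p = 0) ps"
    unfolding R_def by (rule punctured_points_filter)
  have "R \<subseteq> {1..length ps}" "i \<in> R" using i t(2) by (auto simp: R_def)
  moreover have "card R = \<delta> + 1"
    using length_punctured_points[OF \<open>R \<subseteq> {1..length ps}\<close>] t(3) unfolding points by simp
  moreover have "min_dist_at_least \<delta> (restrict_code (length ps) R (code_of ps))"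
    unfolding restrict_code_of points
    using ind t by (intro min_dist_line) (auto intro: sorted_wrt_filter)
  ultimately show "\<exists>R\<subseteq>{1..length ps}. i \<in> R \<and> card R \<le> 2 + \<delta> - 1 \<and>
      min_dist_at_least \<delta> (restrict_code (length ps) R (code_of ps))"
    by (intro exI[of _ R]) simp
qed

text \<open>Coordinate 1 already fails: its repair set would have at most 1 + \<delta> - 1 =
  \<delta> points.\<close>

lemma not_is_LRC_1_code_of:
  assumes ind: "sorted_wrt independent ps" and len: "1 < length ps" and "1 < \<delta>"
  shows "\<not> is_LRC (length ps) 1 \<delta> (code_of ps)"
proof
  assume "is_LRC (length ps) 1 \<delta> (code_of ps)"
  then have "\<exists>R\<subseteq>{1..length ps}. 1 \<in> R \<and> card R \<le> 1 + \<delta> - 1 \<and>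
      min_dist_at_least \<delta> (restrict_code (length ps) R (code_of ps))"
    unfolding is_LRC_def using len by (elim conjE ballE[of _ _ 1]) simp_all
  then obtain R where R: "R \<subseteq> {1..length ps}" "1 \<in> R" "card R \<le> \<delta>"
    and dist: "min_dist_at_least \<delta> (restrict_code (length ps) R (code_of ps))"
    by auto
  let ?qs = "punctured_points ({1..length ps} - R) ps"
  have "independent (ps ! 0) (ps ! 1)" using sorted_wrt_nth_less[OF ind _ len, of 0] by simp
  then have "ps ! 0 \<noteq> (0, 0, 0)" by (rule independent_imp_nonzero(1))
  moreover have "1 \<in> set (filter (\<lambda>i. i \<notin> {1..length ps} - R) [1..<length ps + 1])"
    using R(2) len by simp
  \<comment> \<open>The index is left as \<open>1 - 1\<close> to match the mapped function in
    \<open>punctured_points\<close>.\<close>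
  then have "ps ! (1 - 1) \<in> set ?qs"
    unfolding punctured_points_def set_map by (rule imageI)
  moreover have "length ?qs \<le> \<delta>"
    using length_punctured_points[OF R(1)] R(3) by presburger
  ultimately have "\<not> min_dist_at_least \<delta> (code_of ?qs)"
    using sorted_wrt_punctured_points[OF ind] \<open>1 < \<delta>\<close>
    by (metis min_dist_short_independent diff_self_eq_0)
  then show False using dist by (simp add: restrict_code_of)
qed

lemma optimal_LRC_code_of:
  assumes ind: "sorted_wrt independent ps"
    and len: "length ps = d + (\<delta> + 1)" and d: "\<delta> \<le> d" and \<delta>: "2 < \<delta>"
    and le: "\<And>t. t \<noteq> (0, 0, 0) \<Longrightarrow> length (filter (\<lambda>p. dot t p = 0) ps) \<le> \<delta> + 1"
    and cover: "\<And>p. p \<in> set ps \<Longrightarrow>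
      \<exists>t. t \<noteq> (0, 0, 0) \<and> dot t p = 0 \<and> length (filter (\<lambda>p. dot t p = 0) ps) = \<delta> + 1"
  shows "optimal_LRC (length ps) 3 d 2 \<delta> (code_of ps)"
proof -
  have "ps \<noteq> []" using len by auto
  then obtain t where "t \<noteq> (0, 0, 0)" "length (filter (\<lambda>p. dot t p = 0) ps) = \<delta> + 1"
    using cover by (meson hd_in_set)
  then have "min_dist (code_of ps) = d"
    using len d \<delta> le by (intro min_dist_code_of) auto
  moreover have "code_dim (length ps) (code_of ps) = 3"
  \<comment> \<open>A line containing all points would carry d + \<delta> + 1 of them, more than
    \<delta> + 1.\<close>
  proof (rule code_dim_code_of, rule ccontr)
    fix t :: "'a \<times> 'a \<times> 'a"
    assume "t \<noteq> (0, 0, 0)" "\<not> (\<exists>p\<in>set ps. dot t p \<noteq> 0)"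
    then have "length ps \<le> \<delta> + 1" using le[of t] by simp
    then show False using len d \<delta> by simp
  qed
  ultimately have "is_code (length ps) 3 d (code_of ps)"
    by (simp add: is_code_def linear_code_code_of)
  moreover have "is_LRC (length ps) 2 \<delta> (code_of ps)"
    using ind cover by (rule is_LRC_code_of)
  moreover have "d_optimal (length ps) 3 d 2 \<delta>"
  proof -
    \<comment> \<open>The bound becomes n - 3 + 1 - (\<delta> - 1) = n - \<delta> - 1, which is
      \<open>d\<close> by the assumed length.\<close>
    have "\<lceil>real 3 / real 2\<rceil> = 2" by (simp add: ceiling_eq_iff)
    then show ?thesis unfolding d_optimal_def using len by simp
  qed
  moreover have "r_optimal (length ps) 2 \<delta> (code_of ps)"
    unfolding r_optimal_def
  proof (intro allI impI)
    fix r' :: nat assume "1 \<le> r' \<and> r' < 2"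
    then have "r' = 1" by simp
    then show "\<not> is_LRC (length ps) r' \<delta> (code_of ps)"
      using not_is_LRC_1_code_of[OF ind] len \<delta> by simp
  qed
  ultimately show ?thesis using d \<delta> by (simp add: optimal_LRC_def)
qed


section \<open>The columns of the generator matrix\<close>

text \<open>An explicit list, so that quantifiers over forms can be evaluated. Each line occurs
  three times, once for each nonzero scalar, which does not affect the checks.\<close>

definition forms :: "(gf4 \<times> gf4 \<times> gf4) list" where
  "forms = filter (\<lambda>t. t \<noteq> (0, 0, 0))
    (List.product [F0, F1, w, w2] (List.product [F0, F1, w, w2] [F0, F1, w, w2]))"

lemma set_forms: "set forms = {t. t \<noteq> (0, 0, 0)}"
proof -
  have "set [F0, F1, w, w2] = UNIV"
    using gf4.exhaust by auto
  then show ?thesis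
    by (simp only: forms_def set_filter set_product UNIV_Times_UNIV UNIV_I simp_thms)
qed

definition lines :: "(gf4 \<times> gf4 \<times> gf4) list \<Rightarrow> (gf4 \<times> gf4 \<times> gf4) list list" where
  "lines ps = map (\<lambda>t. filter (\<lambda>p. dot t p = 0) ps) forms"

(* A separate function of ls, so that code_simp evaluates the list of lines only once. *)
definition covers :: "'a list list \<Rightarrow> 'a list \<Rightarrow> bool" where
  "covers ls ps \<longleftrightarrow> (\<forall>l\<in>set ls. length l \<le> 5) \<and> (\<forall>p\<in>set ps. \<exists>l\<in>set ls. length l = 5 \<and> p \<in> set l)"

lemma optimal_LRC_covers:
  assumes "sorted_wrt independent ps" "covers (lines ps) ps" "length ps = d + 5" "4 \<le> d"
  shows "optimal_LRC (d + 5) 3 d 2 4 (code_of ps)"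
proof -
  have le: "\<forall>t\<in>set forms. length (filter (\<lambda>p. dot t p = 0) ps) \<le> 5"
    and cover: "\<forall>p\<in>set ps. \<exists>t\<in>set forms. dot t p = 0 \<and> length (filter (\<lambda>p. dot t p = 0) ps) = 5"
    using assms(2) by (auto simp: covers_def lines_def)
  have "optimal_LRC (length ps) 3 d 2 4 (code_of ps)"
  proof (rule optimal_LRC_code_of)
    show "length (filter (\<lambda>p. dot t p = 0) ps) \<le> 4 + 1" if "t \<noteq> (0, 0, 0)" for t
      using bspec[OF le, of t] that unfolding set_forms by simp
    show "\<exists>t. t \<noteq> (0, 0, 0) \<and> dot t p = 0 \<and> length (filter (\<lambda>p. dot t p = 0) ps) = 4 + 1"
      if "p \<in> set ps" for p
      using bspec[OF cover that] unfolding set_forms by (elim bexE) (intro exI, simp)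
  qed (use assms in simp_all)
  then show ?thesis using assms(3) by simp
qed

text \<open>The rows of \<open>G\<close> are zipped into a list of columns, a form suited to
  evaluation.\<close>

definition G_points :: "(gf4 \<times> gf4 \<times> gf4) list" where
  "G_points =
    zip [0, 0, 0, 0,   0, 1,   1, 1, 1, 1,   1, 1, 1, 1,   1, 1, w^2, 1,   1,   w, 1]
    (zip [1, 0, 1, 1,   1, w^2, 1, w, 0, w^2, w, 0, 1, w^2, 0, 1, 1,   0,   1,   1, w]
         [0, 1, w, w^2, 1, 0,   0, 0, 0, 1,   1, 1, 1, w,   w, w, 1,   w^2, w^2, 1, w^2])"

lemma length_G_points: "length G_points = 21"
  by (simp add: G_points_def)

lemma G_carrier: "G \<in> carrier_mat 3 21"
  unfolding G_def mat_of_rows_list_def by (rule carrier_matI) simp_all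

lemma G_points_nth: "i < 21 \<Longrightarrow> G_points ! i = (G $$ (0, i), G $$ (1, i), G $$ (2, i))"
  unfolding G_def G_points_def
  by (simp add: mat_of_rows_list_def del: zip_Cons_Cons)

text \<open>A combination of the rows with coefficients \<open>y\<close> has as its entries the form
  \<open>y\<close> evaluated at the columns.\<close>

lemma C\<^sub>G_eq: "C\<^sub>G = code_of G_points"
proof -
  have mult: "G\<^sup>T *\<^sub>v y = word G_points (y $ 0, y $ 1, y $ 2)" if y: "y \<in> carrier_vec 3" for y
  proof (rule eq_vecI)
    fix i assume "i < dim_vec (word G_points (y $ 0, y $ 1, y $ 2))"
    then have i: "i < 21" by (simp add: length_G_points)
    have "(G\<^sup>T *\<^sub>v y) $ i = G $$ (0, i) * y $ 0 + G $$ (1, i) * y $ 1 + G $$ (2, i) * y $ 2"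
      using i y G_carrier by (simp add: scalar_prod_def numeral_3_eq_3 numeral_2_eq_2)
    then show "(G\<^sup>T *\<^sub>v y) $ i = word G_points (y $ 0, y $ 1, y $ 2) $ i"
      using i by (simp add: length_G_points G_points_nth mult.commute)
  qed (use G_carrier in \<open>simp add: length_G_points\<close>)
  have surj: "\<exists>y\<in>carrier_vec 3. G\<^sup>T *\<^sub>v y = word G_points t" for t
  proof -
    obtain a b c where t: "t = (a, b, c)" by (cases t)
    then show ?thesis
      using mult[of "vec 3 (\<lambda>i. [a, b, c] ! i)"]
      by (intro bexI[of _ "vec 3 (\<lambda>i. [a, b, c] ! i)"]) simp_all
  qed
  have "C\<^sub>G = {x \<in> carrier_vec 21. \<exists>y\<in>carrier_vec 3. G\<^sup>T *\<^sub>v y = x}"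
    unfolding C\<^sub>G_def using vec_space.row_space_eq[OF G_carrier] G_carrier by auto
  also have "\<dots> = code_of G_points"
    using code_of_carrier[of G_points] surj
    by (auto simp: length_G_points mult code_of_def)
  finally show ?thesis .
qed

lemma independent_G_points: "sorted_wrt independent G_points"
  by code_simp

text \<open>Being 21 and pairwise independent, the columns represent all points of the plane over
  \<open>gf4\<close>, so every line carries exactly five of them.\<close>

lemma covers_G_points: "covers (lines G_points) G_points"
  by code_simp

text \<open>Independence is inherited from the full list, so only the incidences of points and lines
  and the length remain to be evaluated for each \<open>S\<close>.\<close>

lemma optimal_LRC_puncture:
  assumes "covers (lines (punctured_points S G_points)) (punctured_points S G_points)"
    and "length (punctured_points S G_points) = d + 5" "4 \<le> d"
  shows "optimal_LRC (d + 5) 3 d 2 4 (puncture S C\<^sub>G)"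
  unfolding C\<^sub>G_eq puncture_code_of
  using sorted_wrt_punctured_points[OF independent_G_points] assms by (rule optimal_LRC_covers)

text \<open>The lengths stay sums, so that they match the \<open>d + 5\<close> of the general rule
  and of the final statement.\<close>

lemma optimal_LRC_punctured:
  "optimal_LRC (15 + 5) 3 15 2 4 (puncture {2} C\<^sub>G)"
  "optimal_LRC (14 + 5) 3 14 2 4 (puncture {2, 3} C\<^sub>G)"
  "optimal_LRC (13 + 5) 3 13 2 4 (puncture {2, 3, 4} C\<^sub>G)"
  "optimal_LRC (12 + 5) 3 12 2 4 (puncture {2, 3, 4, 5} C\<^sub>G)"
  "optimal_LRC (11 + 5) 3 11 2 4 (puncture {13, 17, 18, 19, 21} C\<^sub>G)"
  "optimal_LRC (10 + 5) 3 10 2 4 (puncture {15, 16, 17, 18, 19, 21} C\<^sub>G)"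
  "optimal_LRC (9 + 5) 3 9 2 4 (puncture {12, 13, 16, 17, 18, 19, 21} C\<^sub>G)"
  "optimal_LRC (8 + 5) 3 8 2 4 (puncture {14..21} C\<^sub>G)"
  "optimal_LRC (7 + 5) 3 7 2 4 (puncture {11, 12, 13, 15, 16, 17, 18, 19, 21} C\<^sub>G)"
  by (rule optimal_LRC_puncture; code_simp)+

theorem mainTheorem11:
  shows "optimal_LRC 21 3 16 2 4 C\<^sub>G \<and>
    (\<forall>(d, S) \<in> {(15, {2}),
                 (14, {2, 3}),
                 (13, {2, 3, 4}),
                 (12, {2, 3, 4, 5}),
                 (11, {13, 17, 18, 19, 21}),
                 (10, {15, 16, 17, 18, 19, 21}),
                 (9, {12, 13, 16, 17, 18, 19, 21}),
                 (8, {14..21}),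
                 (7, {11, 12, 13, 15, 16, 17, 18, 19, 21})}.
       optimal_LRC (d + 5) 3 d 2 4 (puncture S C\<^sub>G))"
proof (intro conjI)
  show "optimal_LRC 21 3 16 2 4 C\<^sub>G"
    unfolding C\<^sub>G_eq
    using optimal_LRC_covers[OF independent_G_points covers_G_points, of 16] length_G_points by simp
qed (simp only: ball_simps prod.case simp_thms optimal_LRC_punctured)

end
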